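(* Let $(\pi_0,K,g)$ be a state-space model with random observations $\{Y_t\}_{t\ge 1}$, let $\{\pi_{Y_{1:t}}\}_{t\ge 1}$ be the associated random filtering sequence, with $\pi_{Y_{1:0}}:=\pi_0$, and let $M_{\pi_{Y_{1:t}}}=\mathbb E[\pi_{Y_{1:t}}]$ denote the corresponding mean measures (so $M_{\pi_{Y_{1:0}}}=\pi_0$). Then, for every $t\ge 1$, the mean measures satisfy the linear recursion $$M_{\pi_{Y_{1:t}}}=K_t\big(M_{\pi_{Y_{1:t-1}}}\big).$$ Equivalently, $M_{\pi_{Y_{1:t}}}(f)=K_t(M_{\pi_{Y_{1:t-1}}})(f)$ for every measurable test function $f:\mathcal X\to\mathbb R$ for which these integrals are defined.
   Context: Let $(\Omega,\mathcal F,\mathbb P)$ be a probability space, $\mathcal X\subseteq\mathbb R^{d_x}$ and $\mathcal Y\subseteq\mathbb R^{d_y}$ Borel sets. A state-space model $(\pi_0,K,g)$ consists of a probability measure $\pi_0$ on $\mathcal X$, Markov kernels $K=\{K_t\}_{t\ge1}$ on $\mathcal X$, and measurable functions $g_t:\mathcal Y\times\mathcal X\to(0,\infty)$, $t\ge 1$, with $\int_{\mathcal Y}g_t(y\mid x)\,dy=1$ for all $x\in\mathcal X$. The state process satisfies $X_0\sim\pi_0$ and is Markov with $\mathbb P(X_t\in A\mid X_{t-1}=x)=K_t(x,A)$; the observations $Y_t$ are conditionally independent given the states, and given $X_t=x$ the variable $Y_t$ has density $g_t(\cdot\mid x)$ with respect to Lebesgue measure on $\mathcal Y$. Write $g_{y_t}(x):=g_t(y_t\mid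 x)$, $\mu(f):=\int f\,d\mu$, and $K_t(\mu)(A):=\int_{\mathcal X}K_t(x,A)\,\mu(dx)$. The random filter is defined recursively by $\xi_{Y_{1:t-1}}:=K_t(\pi_{Y_{1:t-1}})$ and $\pi_{Y_{1:t}}(dx):=g_{Y_t}(x)\,\xi_{Y_{1:t-1}}(dx)/\xi_{Y_{1:t-1}}(g_{Y_t})$. The mean measure of a random measure $\mu_Y$ on $\mathcal X$ is $M_{\mu_Y}(B):=\mathbb E[\mu_Y(B)]$ for Borel $B\subseteq\mathcal X$. *)

theory Defs
  imports "HOL-Probability.Probability"
begin

abbreviation borel_on :: "'a::topological_space set \<Rightarrow> 'a measure" where
  "borel_on S \<equiv> restrict_space borel S"

text \<open>
  \<^const>\<open>prob_algebra\<close> is the space of probability measures with the evaluation sigma-algebra, so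
  \<open>K t \<in> borel_on X \<rightarrow>\<^sub>M prob_algebra (borel_on X)\<close> says that \<open>K t\<close> is a Markov kernel on \<open>X\<close>.
  The values \<open>K 0\<close> and \<open>g 0\<close> are unconstrained and never used. The density is written
  \<open>g t y x\<close> for $g_t(y \mid x)$.
\<close>

locale state_space_model =
  fixes X :: "'x::euclidean_space set"
    and Y :: "'y::euclidean_space set"
    and pi0 :: "'x measure"
    and K :: "nat \<Rightarrow> 'x \<Rightarrow> 'x measure"
    and g :: "nat \<Rightarrow> 'y \<Rightarrow> 'x \<Rightarrow> real"
  assumes X_borel: "X \<in> sets borel"
    and Y_borel: "Y \<in> sets borel"
    and pi0_prob: "pi0 \<in> space (prob_algebra (borel_on X))"
    and K_kernel: "\<And>t. t \<ge> 1 \<Longrightarrow> K t \<in> borel_on X \<rightarrow>\<^sub>M prob_algebra (borel_on X)"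
    and g_measurable: "\<And>t. t \<ge> 1 \<Longrightarrow>
          (\<lambda>(y, x). g t y x) \<in> borel_measurable (borel_on Y \<Otimes>\<^sub>M borel_on X)"
    and g_pos: "\<And>t x y. t \<ge> 1 \<Longrightarrow> x \<in> X \<Longrightarrow> y \<in> Y \<Longrightarrow> 0 < g t y x"
    and g_density: "\<And>t x. t \<ge> 1 \<Longrightarrow> x \<in> X \<Longrightarrow>
          (\<integral>\<^sup>+ y. ennreal (g t y x) \<partial>restrict_space lborel Y) = 1"

definition sigma_generated ::
    "'w measure \<Rightarrow> nat set \<Rightarrow> (nat \<Rightarrow> 'w \<Rightarrow> 'x) \<Rightarrow> 'x measure \<Rightarrow> 'w measure" where
  "sigma_generated M I Z N =
     sigma (space M) {Z s -` A \<inter> space M | s A. s \<in> I \<and> A \<in> sets N}"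

text \<open>
  Conditional probability of an event given a sub-sigma-algebra, a random variable determined
  up to almost sure equality.
\<close>

definition cond_pr :: "'w measure \<Rightarrow> 'w measure \<Rightarrow> ('w \<Rightarrow> bool) \<Rightarrow> 'w \<Rightarrow> real" where
  "cond_pr M F P = real_cond_exp M F (indicator {w \<in> space M. P w})"

text \<open>
  The states are indexed from time 0, the observations from time 1 (\<open>Obs 0\<close> is unconstrained).
  In the last two axioms one conditions on the sigma-algebra of the whole state process:
  given all the states, the observations are independent, and the conditional law of the
  observation at time \<open>t\<close> depends on the state at time \<open>t\<close> only, with density
  $g_t(\cdot \mid x)$ when that state is $x$.
\<close>

locale state_space_process = prob_space M + state_space_model X Y pi0 K g
  for M :: "'w measure"
    and X :: "'x::euclidean_space set"
    and Y :: "'y::euclidean_space set"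
    and pi0 :: "'x measure"
    and K :: "nat \<Rightarrow> 'x \<Rightarrow> 'x measure"
    and g :: "nat \<Rightarrow> 'y \<Rightarrow> 'x \<Rightarrow> real" +
  fixes State :: "nat \<Rightarrow> 'w \<Rightarrow> 'x"
    and Obs :: "nat \<Rightarrow> 'w \<Rightarrow> 'y"
  assumes State_measurable: "\<And>t. State t \<in> M \<rightarrow>\<^sub>M borel_on X"
    and Obs_measurable: "\<And>t. t \<ge> 1 \<Longrightarrow> Obs t \<in> M \<rightarrow>\<^sub>M borel_on Y"
    and initial_law: "distr M (borel_on X) (State 0) = pi0"
    and markov: "\<And>t A. t \<ge> 1 \<Longrightarrow> A \<in> sets (borel_on X) \<Longrightarrow>
          AE w in M. cond_pr M (sigma_generated M {..<t} State (borel_on X)) (\<lambda>w. State t w \<in> A) w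
            = measure (K t (State (t - 1) w)) A"
    and obs_cond_indep: "\<And>J B. finite J \<Longrightarrow> J \<subseteq> {1..} \<Longrightarrow>
          (\<And>j. j \<in> J \<Longrightarrow> B j \<in> sets (borel_on Y)) \<Longrightarrow>
          AE w in M. cond_pr M (sigma_generated M UNIV State (borel_on X)) (\<lambda>w. \<forall>j\<in>J. Obs j w \<in> B j) w
            = (\<Prod>j\<in>J. cond_pr M (sigma_generated M UNIV State (borel_on X)) (\<lambda>w. Obs j w \<in> B j) w)"
    and obs_density: "\<And>t B. t \<ge> 1 \<Longrightarrow> B \<in> sets (borel_on Y) \<Longrightarrow>
          AE w in M. cond_pr M (sigma_generated M UNIV State (borel_on X)) (\<lambda>w. Obs t w \<in> B) w
            = (LINT y:B|lborel. g t y (State t w))"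

text \<open>
  The monadic bind gives $K(\mu)(A) = \int K(x,A)\,\mu(dx)$.
\<close>

definition kernel_push :: "('x \<Rightarrow> 'x measure) \<Rightarrow> 'x measure \<Rightarrow> 'x measure" where
  "kernel_push k \<mu> = \<mu> \<bind> k"

lemma emeasure_kernel_push:
  assumes "sets \<mu> = sets N" "space N \<noteq> {}" "k \<in> N \<rightarrow>\<^sub>M prob_algebra N" "A \<in> sets N"
  shows "emeasure (kernel_push k \<mu>) A = (\<integral>\<^sup>+ x. emeasure (k x) A \<partial>\<mu>)"
proof -
  have "k \<in> \<mu> \<rightarrow>\<^sub>M subprob_algebra N"
    using measurable_prob_algebraD[OF assms(3)] measurable_cong_sets[OF assms(1) refl] by blast
  moreover have "space \<mu> \<noteq> {}" using assms(1,2) sets_eq_imp_space_eq by blast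
  ultimately show ?thesis unfolding kernel_push_def using assms(4) by (intro emeasure_bind)
qed

text \<open>
  Division is that of \<^typ>\<open>ennreal\<close>: the result is the null measure if the normalising constant
  is infinite, which can happen only for a Lebesgue null set of observations.
\<close>

definition bayes_update :: "('x \<Rightarrow> real) \<Rightarrow> 'x measure \<Rightarrow> 'x measure" where
  "bayes_update h \<xi> = density \<xi> (\<lambda>x. ennreal (h x) / (\<integral>\<^sup>+ z. ennreal (h z) \<partial>\<xi>))"

primrec filtering ::
    "'x measure \<Rightarrow> (nat \<Rightarrow> 'x \<Rightarrow> 'x measure) \<Rightarrow> (nat \<Rightarrow> 'y \<Rightarrow> 'x \<Rightarrow> real) \<Rightarrow> (nat \<Rightarrow> 'y) \<Rightarrow> nat
      \<Rightarrow> 'x measure" where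
  "filtering pi0 K g y 0 = pi0"
| "filtering pi0 K g y (Suc t) =
     bayes_update (g (Suc t) (y (Suc t))) (kernel_push (K (Suc t)) (filtering pi0 K g y t))"

definition random_filter ::
    "'x measure \<Rightarrow> (nat \<Rightarrow> 'x \<Rightarrow> 'x measure) \<Rightarrow> (nat \<Rightarrow> 'y \<Rightarrow> 'x \<Rightarrow> real) \<Rightarrow> (nat \<Rightarrow> 'w \<Rightarrow> 'y) \<Rightarrow> nat
      \<Rightarrow> 'w \<Rightarrow> 'x measure" where
  "random_filter pi0 K g Obs t w = filtering pi0 K g (\<lambda>s. Obs s w) t"

definition mean_measure :: "'w measure \<Rightarrow> 'x measure \<Rightarrow> ('w \<Rightarrow> 'x measure) \<Rightarrow> 'x measure" where
  "mean_measure M N \<mu> = measure_of (space N) (sets N) (\<lambda>B. \<integral>\<^sup>+ w. emeasure (\<mu> w) B \<partial>M)"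

definition mean_filter ::
    "'w measure \<Rightarrow> 'x::topological_space set \<Rightarrow> 'x measure \<Rightarrow> (nat \<Rightarrow> 'x \<Rightarrow> 'x measure)
      \<Rightarrow> (nat \<Rightarrow> 'y \<Rightarrow> 'x \<Rightarrow> real) \<Rightarrow> (nat \<Rightarrow> 'w \<Rightarrow> 'y) \<Rightarrow> nat \<Rightarrow> 'x measure" where
  "mean_filter M X pi0 K g Obs t = mean_measure M (borel_on X) (random_filter pi0 K g Obs t)"

text \<open>
  \<^const>\<open>measure_of\<close> is junk unless its last argument is a measure. For random measures it is, and
  the filter is a random measure, as shown next.
\<close>

lemma emeasure_mean_measure:
  assumes \<mu>: "\<mu> \<in> M \<rightarrow>\<^sub>M subprob_algebra N" and B: "B \<in> sets N"
  shows "emeasure (mean_measure M N \<mu>) B = (\<integral>\<^sup>+ w. emeasure (\<mu> w) B \<partial>M)"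
  unfolding mean_measure_def
proof (rule emeasure_measure_of_sigma[OF sets.sigma_algebra_axioms _ _ B])
  show "positive (sets N) (\<lambda>B. \<integral>\<^sup>+ w. emeasure (\<mu> w) B \<partial>M)"
    by (simp add: positive_def)
  show "countably_additive (sets N) (\<lambda>B. \<integral>\<^sup>+ w. emeasure (\<mu> w) B \<partial>M)"
  proof (rule countably_additiveI)
    fix A :: "nat \<Rightarrow> _" assume A: "range A \<subseteq> sets N" "disjoint_family A"
    have m: "(\<lambda>w. emeasure (\<mu> w) (A i)) \<in> borel_measurable M" for i
      using A(1) by (intro measurable_emeasure_kernel[OF \<mu>]) auto
    have "(\<Sum>i. \<integral>\<^sup>+ w. emeasure (\<mu> w) (A i) \<partial>M) = (\<integral>\<^sup>+ w. (\<Sum>i. emeasure (\<mu> w) (A i)) \<partial>M)"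
      by (rule nn_integral_suminf[symmetric]) (rule m)
    also have "\<dots> = (\<integral>\<^sup>+ w. emeasure (\<mu> w) (\<Union> (range A)) \<partial>M)"
    proof (rule nn_integral_cong)
      fix w assume "w \<in> space M"
      then have "sets (\<mu> w) = sets N" using sets_kernel[OF \<mu>] by simp
      then show "(\<Sum>i. emeasure (\<mu> w) (A i)) = emeasure (\<mu> w) (\<Union> (range A))"
        using A by (intro suminf_emeasure) auto
    qed
    finally show "(\<Sum>i. \<integral>\<^sup>+ w. emeasure (\<mu> w) (A i) \<partial>M)
      = (\<integral>\<^sup>+ w. emeasure (\<mu> w) (\<Union> (range A)) \<partial>M)" .
  qed
qed

lemma (in state_space_process) random_filter_measurable:
  "random_filter pi0 K g Obs t \<in> M \<rightarrow>\<^sub>M subprob_algebra (borel_on X)"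
proof (induction t)
  case 0
  have "pi0 \<in> space (subprob_algebra (borel_on X))"
    using pi0_prob by (simp add: space_prob_algebra space_subprob_algebra prob_space_imp_subprob_space)
  then show ?case
    by (simp add: random_filter_def[abs_def])
next
  case (Suc t)
  let ?N = "borel_on X"
  let ?xi = "\<lambda>w. kernel_push (K (Suc t)) (random_filter pi0 K g Obs t w)"
  let ?h = "\<lambda>w x. g (Suc t) (Obs (Suc t) w) x"
  let ?c = "\<lambda>w. \<integral>\<^sup>+ z. ennreal (?h w z) \<partial>?xi w"
  have K: "K (Suc t) \<in> ?N \<rightarrow>\<^sub>M subprob_algebra ?N"
    using measurable_prob_algebraD[OF K_kernel] by simp
  have xi: "?xi \<in> M \<rightarrow>\<^sub>M subprob_algebra ?N"
    unfolding kernel_push_def using Suc K by (rule measurable_bind2)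
  have "(\<lambda>p. (Obs (Suc t) (fst p), snd p)) \<in> M \<Otimes>\<^sub>M ?N \<rightarrow>\<^sub>M borel_on Y \<Otimes>\<^sub>M ?N"
    by (intro measurable_Pair measurable_compose[OF measurable_fst Obs_measurable] measurable_snd) simp
  from measurable_compose[OF this g_measurable[of "Suc t"]]
  have h: "(\<lambda>(w, x). ennreal (?h w x)) \<in> borel_measurable (M \<Otimes>\<^sub>M ?N)"
    by (simp add: split_beta')
  have c[measurable]: "?c \<in> borel_measurable M"
    by (rule nn_integral_measurable_subprob_algebra2[OF h xi])
  have q: "(\<lambda>(w, x). ennreal (?h w x) / ?c w) \<in> borel_measurable (M \<Otimes>\<^sub>M ?N)"
  proof -
    have "(\<lambda>p. ennreal (?h (fst p) (snd p)) / ?c (fst p)) \<in> borel_measurable (M \<Otimes>\<^sub>M ?N)"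
      using h measurable_compose[OF measurable_fst c] by (intro borel_measurable_divide_ennreal) (auto simp: split_beta')
    then show ?thesis by (simp add: split_beta')
  qed
  have eq: "random_filter pi0 K g Obs (Suc t) w = density (?xi w) (\<lambda>x. ennreal (?h w x) / ?c w)" for w
    by (simp add: random_filter_def bayes_update_def)
  have sx: "sets (?xi w) = sets ?N" if "w \<in> space M" for w
    using sets_kernel[OF xi that] .
  have hw: "(\<lambda>x. ennreal (?h w x)) \<in> borel_measurable (?xi w)" if "w \<in> space M" for w
    using measurable_Pair2[OF h that] by (simp add: measurable_cong_sets[OF sx[OF that] refl])
  have qw: "(\<lambda>x. ennreal (?h w x) / ?c w) \<in> borel_measurable (?xi w)" if "w \<in> space M" for w
    using hw[OF that] by (intro borel_measurable_divide_ennreal) auto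
  have em: "emeasure (random_filter pi0 K g Obs (Suc t) w) A
      = (\<integral>\<^sup>+ x. ennreal (?h w x) / ?c w * indicator A x \<partial>?xi w)"
    if "w \<in> space M" "A \<in> sets ?N" for w A
    unfolding eq using qw[OF that(1)] that(2) sx[OF that(1)] by (intro emeasure_density) auto
  show ?case
  proof (rule measurable_subprob_algebra)
    fix w assume w: "w \<in> space M"
    show "sets (random_filter pi0 K g Obs (Suc t) w) = sets ?N"
      using sx[OF w] by (simp add: eq)
    have sp: "space (?xi w) = X"
      using sets_eq_imp_space_eq[OF sx[OF w]] by (simp add: space_restrict_space)
    have sub: "subprob_space (?xi w)"
      using measurable_space[OF xi w] by (simp add: space_subprob_algebra)
    show "subprob_space (random_filter pi0 K g Obs (Suc t) w)"
    proof
      have "emeasure (random_filter pi0 K g Obs (Suc t) w) X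
          = (\<integral>\<^sup>+ x. ennreal (?h w x) / ?c w * indicator X x \<partial>?xi w)"
        using w by (intro em) (auto simp: sets_restrict_space)
      also have "\<dots> = (\<integral>\<^sup>+ x. ennreal (?h w x) / ?c w \<partial>?xi w)"
        by (intro nn_integral_cong) (simp add: sp)
      also have "\<dots> = ?c w / ?c w"
        using hw[OF w] by (intro nn_integral_divide)
      also have "\<dots> \<le> 1"
        by (cases "?c w = 0 \<or> ?c w = top") (auto simp: ennreal_top_divide ennreal_divide_self less_top)
      finally show "emeasure (random_filter pi0 K g Obs (Suc t) w)
          (space (random_filter pi0 K g Obs (Suc t) w)) \<le> 1"
        by (simp add: eq sp)
      show "space (random_filter pi0 K g Obs (Suc t) w) \<noteq> {}"
        using subprob_space.subprob_not_empty[OF sub] by (simp add: eq)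
    qed
  next
    fix A assume A: "A \<in> sets ?N"
    have "(\<lambda>w. \<integral>\<^sup>+ x. ennreal (?h w x) / ?c w * indicator A x \<partial>?xi w) \<in> borel_measurable M"
    proof (rule nn_integral_measurable_subprob_algebra2[OF _ xi])
      have "(\<lambda>p. (indicator A (snd p) :: ennreal)) \<in> borel_measurable (M \<Otimes>\<^sub>M ?N)"
        using A by measurable
      then show "(\<lambda>(w, x). ennreal (?h w x) / ?c w * indicator A x) \<in> borel_measurable (M \<Otimes>\<^sub>M ?N)"
        using q by (auto simp: split_beta')
    qed
    then show "(\<lambda>w. emeasure (random_filter pi0 K g Obs (Suc t) w) A) \<in> borel_measurable M"
      using em[OF _ A] by (subst measurable_cong) auto
  qed
qed

end

theory Submission
  imports Defs
begin

text \<open>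
  The filter at time \<open>n\<close> is the conditional law of the state at time \<open>n\<close> given the observations up to
  time \<open>n\<close>. By the tower property its mean measure is the unconditional law of that state
  (\<open>mean_filter_eq_state_law\<close>), and by the Markov property the law of the state at time \<open>n + 1\<close> is the
  image of the law at time \<open>n\<close> under the transition kernel (\<open>state_law_Suc\<close>). The two facts together
  are the recursion; the statements about test functions follow because both sides are then integrals
  against one and the same measure.
  
  The work is to show that the recursively defined filter is that conditional law. This is expressed
  without conditional expectations, by \<open>filter_correct\<close>: integrating the filter over an event of past
  observations gives the joint probability of that event and of the state. It is proved by induction
  over time, in two steps.
  
  \<^item> Prediction (\<open>predictor_correct\<close>). On a rectangle of past observations, conditional independence
    replaces the observation event by a product of functions of the states at times \<open>1, \<dots>, n\<close>. The
    Markov property then replaces the next state by the kernel applied to the current one, and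
    conditional independence brings the observation event back, so that the induction hypothesis
    applies.
  
  \<^item> Update (\<open>joint_density_correct\<close>, \<open>bayes_formula\<close>). On the event that the new state lies in \<open>A\<close>, the law of
    the past observations and the new one has, with respect to the product of the law of the past and
    Lebesgue measure, the density $\int_A g(y \mid x)\,\xi(dx)$, with $\xi$ the predictor. Taking \<open>A = X\<close>
    gives the law of the observations, whose density is the normalising constant of Bayes' rule. Hence
    integrating the posterior against the law of the observations multiplies the quotient of the two
    densities by its denominator and leaves the numerator. The denominator is the density of a
    probability measure, hence finite almost everywhere, and where it vanishes the numerator does too.
\<close>

section \<open>Bayes updates of random measures\<close>

lemma emeasure_bayes_update:
  assumes h: "(\<lambda>x. ennreal (h x)) \<in> borel_measurable \<xi>" and A: "A \<in> sets \<xi>"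
  shows "emeasure (bayes_update h \<xi>) A
    = (\<integral>\<^sup>+x. ennreal (h x) * indicator A x \<partial>\<xi>) / (\<integral>\<^sup>+x. ennreal (h x) \<partial>\<xi>)"
proof -
  have "emeasure (bayes_update h \<xi>) A
      = (\<integral>\<^sup>+x. ennreal (h x) / (\<integral>\<^sup>+z. ennreal (h z) \<partial>\<xi>) * indicator A x \<partial>\<xi>)"
    unfolding bayes_update_def using h A
    by (intro emeasure_density borel_measurable_divide_ennreal) auto
  also have "\<dots> = (\<integral>\<^sup>+x. ennreal (h x) * indicator A x / (\<integral>\<^sup>+z. ennreal (h z) \<partial>\<xi>) \<partial>\<xi>)"
    by (simp add: divide_ennreal_def mult_ac)
  also have "\<dots> = (\<integral>\<^sup>+x. ennreal (h x) * indicator A x \<partial>\<xi>) / (\<integral>\<^sup>+x. ennreal (h x) \<partial>\<xi>)"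
    using h A by (intro nn_integral_divide) auto
  finally show ?thesis .
qed

text \<open>
  The update is a kernel again. Its total mass is the normalising constant divided by itself, which is
  at most 1 also in the degenerate cases \<open>0 / 0\<close> and \<open>\<infinity> / \<infinity>\<close>; both quotients are 0. Subprobability
  kernels are therefore the class in which the filter lives for every observation sequence.
\<close>

lemma bayes_update_measurable:
  assumes \<xi>: "\<xi> \<in> N \<rightarrow>\<^sub>M subprob_algebra B"
    and h: "(\<lambda>(w, x). ennreal (h w x)) \<in> borel_measurable (N \<Otimes>\<^sub>M B)"
  shows "(\<lambda>w. bayes_update (h w) (\<xi> w)) \<in> N \<rightarrow>\<^sub>M subprob_algebra B"
proof (rule measurable_subprob_algebra)
  have hw: "(\<lambda>x. ennreal (h w x)) \<in> borel_measurable (\<xi> w)" if "w \<in> space N" for w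
    using measurable_Pair2[OF h that] by (simp add: measurable_cong_sets[OF sets_kernel[OF \<xi> that] refl])
  fix w assume w: "w \<in> space N"
  show sets: "sets (bayes_update (h w) (\<xi> w)) = sets B"
    using sets_kernel[OF \<xi> w] by (simp add: bayes_update_def)
  have space: "space (bayes_update (h w) (\<xi> w)) = space (\<xi> w)"
    by (simp add: bayes_update_def)
  show "subprob_space (bayes_update (h w) (\<xi> w))"
  proof
    let ?c = "\<integral>\<^sup>+x. ennreal (h w x) \<partial>\<xi> w"
    have "emeasure (bayes_update (h w) (\<xi> w)) (space (\<xi> w)) = ?c / ?c"
      by (simp add: emeasure_bayes_update[OF hw[OF w]] cong: nn_integral_cong)
    also have "\<dots> \<le> 1"
      by (cases "?c = 0 \<or> ?c = top") (auto simp: ennreal_top_divide ennreal_divide_self less_top)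
    finally show "emeasure (bayes_update (h w) (\<xi> w)) (space (bayes_update (h w) (\<xi> w))) \<le> 1"
      by (simp add: space)
    show "space (bayes_update (h w) (\<xi> w)) \<noteq> {}"
      unfolding space by (rule subprob_space.subprob_not_empty[OF subprob_space_kernel[OF \<xi> w]])
  qed
next
  fix A assume A: "A \<in> sets B"
  have hA: "(\<lambda>(w, x). ennreal (h w x) * indicator A x) \<in> borel_measurable (N \<Otimes>\<^sub>M B)"
  proof -
    have "(\<lambda>p. (indicator A (snd p) :: ennreal)) \<in> borel_measurable (N \<Otimes>\<^sub>M B)"
      using A by measurable
    then show ?thesis using h by (auto simp: split_beta')
  qed
  have "(\<lambda>w. (\<integral>\<^sup>+x. ennreal (h w x) * indicator A x \<partial>\<xi> w) / (\<integral>\<^sup>+x. ennreal (h w x) \<partial>\<xi> w))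
      \<in> borel_measurable N"
    using nn_integral_measurable_subprob_algebra2[OF hA \<xi>] nn_integral_measurable_subprob_algebra2[OF h \<xi>]
    by (rule borel_measurable_divide_ennreal)
  moreover have "emeasure (bayes_update (h w) (\<xi> w)) A
      = (\<integral>\<^sup>+x. ennreal (h w x) * indicator A x \<partial>\<xi> w) / (\<integral>\<^sup>+x. ennreal (h w x) \<partial>\<xi> w)"
    if w: "w \<in> space N" for w
    using measurable_Pair2[OF h w] A sets_kernel[OF \<xi> w]
    by (intro emeasure_bayes_update) (auto simp: measurable_cong_sets[OF sets_kernel[OF \<xi> w] refl])
  ultimately show "(\<lambda>w. emeasure (bayes_update (h w) (\<xi> w)) A) \<in> borel_measurable N"
    by (subst measurable_cong) auto
qed

section \<open>Conditioning\<close>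

text \<open>
  If a kernel \<open>\<kappa>\<close> gives the right joint probabilities of \<open>S\<close> with one fixed event of \<open>U\<close>, it gives the
  right integrals of all functions of \<open>S\<close> over that event: the law of \<open>S\<close> on the event is the mixture
  of the measures \<open>\<kappa> (U w)\<close>. Keeping the event fixed makes the lemma applicable when the hypothesis is
  known for rectangles only.
\<close>

lemma (in prob_space) nn_integral_disintegration:
  assumes U[measurable]: "U \<in> M \<rightarrow>\<^sub>M V" and S[measurable]: "S \<in> M \<rightarrow>\<^sub>M N"
    and \<kappa>: "\<kappa> \<in> V \<rightarrow>\<^sub>M subprob_algebra N" and C[measurable]: "C \<in> sets V"
    and eq: "\<And>A. A \<in> sets N \<Longrightarrow> (\<integral>\<^sup>+w. indicator C (U w) * indicator A (S w) \<partial>M)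
      = (\<integral>\<^sup>+w. indicator C (U w) * emeasure (\<kappa> (U w)) A \<partial>M)"
    and f[measurable]: "f \<in> borel_measurable N"
  shows "(\<integral>\<^sup>+w. indicator C (U w) * f (S w) \<partial>M)
      = (\<integral>\<^sup>+w. indicator C (U w) * (\<integral>\<^sup>+x. f x \<partial>\<kappa> (U w)) \<partial>M)"
proof -
  let ?D = "density M (\<lambda>w. indicator C (U w))"
  have \<kappa>U[measurable]: "(\<lambda>w. \<kappa> (U w)) \<in> M \<rightarrow>\<^sub>M subprob_algebra N"
    using U \<kappa> by (rule measurable_compose)
  have \<kappa>D: "(\<lambda>w. \<kappa> (U w)) \<in> ?D \<rightarrow>\<^sub>M subprob_algebra N" by simp
  have ne: "space ?D \<noteq> {}" using not_empty by simp
  have "distr ?D N S = ?D \<bind> (\<lambda>w. \<kappa> (U w))"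
  proof (rule measure_eqI)
    show "sets (distr ?D N S) = sets (?D \<bind> (\<lambda>w. \<kappa> (U w)))"
      using sets_bind[OF sets_kernel[OF \<kappa>D] ne] by simp
    fix A assume "A \<in> sets (distr ?D N S)"
    then have A[measurable]: "A \<in> sets N" by simp
    have "emeasure (distr ?D N S) A = (\<integral>\<^sup>+w. indicator C (U w) * indicator A (S w) \<partial>M)"
      by (subst emeasure_distr) (auto simp: emeasure_density indicator_def intro!: nn_integral_cong)
    also have "\<dots> = emeasure (?D \<bind> (\<lambda>w. \<kappa> (U w))) A"
      unfolding eq[OF A] by (simp add: emeasure_bind[OF ne \<kappa>D A] nn_integral_density)
    finally show "emeasure (distr ?D N S) A = emeasure (?D \<bind> (\<lambda>w. \<kappa> (U w))) A" .
  qed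
  then have "(\<integral>\<^sup>+x. f x \<partial>distr ?D N S) = (\<integral>\<^sup>+x. f x \<partial>(?D \<bind> (\<lambda>w. \<kappa> (U w))))" by simp
  moreover have "(\<integral>\<^sup>+x. f x \<partial>distr ?D N S) = (\<integral>\<^sup>+w. indicator C (U w) * f (S w) \<partial>M)"
    by (subst nn_integral_distr) (simp_all add: nn_integral_density)
  moreover have "(\<integral>\<^sup>+x. f x \<partial>(?D \<bind> (\<lambda>w. \<kappa> (U w))))
      = (\<integral>\<^sup>+w. indicator C (U w) * (\<integral>\<^sup>+x. f x \<partial>\<kappa> (U w)) \<partial>M)"
    unfolding nn_integral_bind[OF f \<kappa>D]
    using measurable_compose[OF \<kappa>U nn_integral_measurable_subprob_algebra[OF f]]
    by (subst nn_integral_density) simp_all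
  ultimately show ?thesis by simp
qed

lemma space_sigma_generated: "space (sigma_generated M I Z N) = space M"
  by (simp add: sigma_generated_def space_measure_of_conv)

lemma sets_sigma_generated:
  "sets (sigma_generated M I Z N)
    = sigma_sets (space M) {Z s -` A \<inter> space M | s A. s \<in> I \<and> A \<in> sets N}"
  unfolding sigma_generated_def by (rule sets_measure_of) auto

lemma subalgebra_sigma_generated:
  assumes "\<And>s. s \<in> I \<Longrightarrow> Z s \<in> M \<rightarrow>\<^sub>M N"
  shows "subalgebra M (sigma_generated M I Z N)"
  unfolding subalgebra_def space_sigma_generated sets_sigma_generated
  using assms by (auto intro!: sets.sigma_sets_subset measurable_sets)

lemma measurable_sigma_generated:
  assumes "s \<in> I" "Z s \<in> M \<rightarrow>\<^sub>M N"
  shows "Z s \<in> sigma_generated M I Z N \<rightarrow>\<^sub>M N"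
  using assms measurable_space[OF assms(2)]
  by (intro measurableI) (auto simp: space_sigma_generated sets_sigma_generated)

text \<open>
  The defining property of conditional probabilities, for functions with values in \<^typ>\<open>ennreal\<close>.
  This form spares all integrability conditions in the computations with products below. The real
  conditional expectation of an indicator is almost surely nonnegative and has the integrals that
  characterise the nonnegative conditional expectation, which satisfies the property for all
  measurable functions.
\<close>

lemma (in prob_space) nn_integral_cond_pr:
  assumes F: "subalgebra M F" and P: "{w \<in> space M. P w} \<in> sets M"
    and r: "AE w in M. cond_pr M F P w = r w"
    and f: "f \<in> borel_measurable F"
  shows "(\<integral>\<^sup>+w. f w * indicator {w \<in> space M. P w} w \<partial>M) = (\<integral>\<^sup>+w. f w * ennreal (r w) \<partial>M)"
proof -
  interpret finite_measure_subalgebra M F by standard (rule F)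
  let ?E = "{w \<in> space M. P w}"
  let ?c = "real_cond_exp M F (indicator ?E)"
  note [measurable] = P
  have int: "integrable M (indicator ?E :: _ \<Rightarrow> real)"
    using P by (simp add: less_top[symmetric])
  have pos: "AE w in M. ?c w \<ge> 0"
    by (rule real_cond_exp_pos) auto
  have "AE w in M. ennreal (?c w) = nn_cond_exp M F (indicator ?E) w"
  proof (rule nn_cond_exp_charact)
    fix A assume A: "A \<in> sets F"
    then have [measurable]: "A \<in> sets M" using F by (auto simp: subalgebra_def)
    have "(\<integral>\<^sup>+w. indicator ?E w * indicator A w \<partial>M) = ennreal (\<integral>w. indicator A w * indicator ?E w \<partial>M)"
      using integrable_mult_indicator[OF \<open>A \<in> sets M\<close> int]
      by (subst nn_integral_eq_integral[symmetric]) (auto intro!: nn_integral_cong simp: indicator_def)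
    also have "(\<integral>w. indicator A w * indicator ?E w \<partial>M) = (\<integral>w. indicator A w * ?c w \<partial>M)"
      using real_cond_exp_intA[OF int A] by (simp add: set_lebesgue_integral_def)
    also have "ennreal \<dots> = (\<integral>\<^sup>+w. ennreal (indicator A w * ?c w) \<partial>M)"
    proof (rule nn_integral_eq_integral[symmetric])
      show "integrable M (\<lambda>w. indicator A w * ?c w)"
        using integrable_mult_indicator[OF \<open>A \<in> sets M\<close> real_cond_exp_int(1)[OF int]] by simp
      show "AE w in M. 0 \<le> indicator A w * ?c w" using pos by (auto simp: indicator_def)
    qed
    also have "\<dots> = (\<integral>\<^sup>+w. ennreal (?c w) * indicator A w \<partial>M)"
      by (intro nn_integral_cong) (auto simp: indicator_def)
    finally show "(\<integral>\<^sup>+w\<in>A. indicator ?E w \<partial>M) = (\<integral>\<^sup>+w\<in>A. ennreal (?c w) \<partial>M)" .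
  qed simp_all
  then have "AE w in M. nn_cond_exp M F (indicator ?E) w = ennreal (r w)"
    using r unfolding cond_pr_def by eventually_elim simp
  then have "(\<integral>\<^sup>+w. f w * nn_cond_exp M F (indicator ?E) w \<partial>M) = (\<integral>\<^sup>+w. f w * ennreal (r w) \<partial>M)"
    by (intro nn_integral_cong_AE) auto
  then show ?thesis using nn_cond_exp_intg[OF f, of "indicator ?E"] by simp
qed

section \<open>The filter as a kernel from observation sequences\<close>

context state_space_model
begin

abbreviation lborel_Y :: "'y measure" where
  "lborel_Y \<equiv> restrict_space lborel Y"

abbreviation obs_space :: "nat \<Rightarrow> (nat \<Rightarrow> 'y) measure" where
  "obs_space n \<equiv> PiM {1..n} (\<lambda>_. borel_on Y)"

text \<open>
  The conditional probability that the observation at time \<open>t\<close> lies in \<open>B\<close> when the state is \<open>x\<close>.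
\<close>

definition obs_prob :: "nat \<Rightarrow> 'y set \<Rightarrow> 'x \<Rightarrow> ennreal" where
  "obs_prob t B x = (\<integral>\<^sup>+y. ennreal (g t y x) * indicator B y \<partial>lborel_Y)"

definition predictor :: "(nat \<Rightarrow> 'y) \<Rightarrow> nat \<Rightarrow> 'x measure" where
  "predictor y n = kernel_push (K (Suc n)) (filtering pi0 K g y n)"

lemma sets_lborel_Y: "sets lborel_Y = sets (borel_on Y)"
  by (simp add: sets_restrict_space)

lemma sigma_finite_lborel_Y: "sigma_finite_measure lborel_Y"
  using Y_borel by (intro sigma_finite_measure_restrict_space sigma_finite_lborel) simp

lemma space_state: "space (borel_on X) = X"
  by (simp add: space_restrict_space)

lemma kernel_measurable: "K (Suc n) \<in> borel_on X \<rightarrow>\<^sub>M subprob_algebra (borel_on X)"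
  using measurable_prob_algebraD[OF K_kernel] by simp

lemma obs_prob_measurable:
  assumes t: "t \<ge> 1" and B: "B \<in> sets (borel_on Y)"
  shows "obs_prob t B \<in> borel_measurable (borel_on X)"
proof -
  interpret sigma_finite_measure lborel_Y by (rule sigma_finite_lborel_Y)
  have [measurable]: "B \<in> sets lborel_Y" using B sets_lborel_Y by simp
  have "(\<lambda>(x, y). g t y x) \<in> borel_measurable (borel_on X \<Otimes>\<^sub>M borel_on Y)"
    using measurable_pair_swap[OF g_measurable[OF t]] by (simp add: split_beta')
  then have [measurable]: "(\<lambda>(x, y). g t y x) \<in> borel_measurable (borel_on X \<Otimes>\<^sub>M lborel_Y)"
    by (simp cong: measurable_cong_sets sets_pair_measure_cong add: sets_lborel_Y)
  show ?thesis unfolding obs_prob_def[abs_def] by measurable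
qed

text \<open>
  A set integral with respect to Lebesgue measure on the whole space only sees \<open>Y\<close>, since \<open>B\<close> is a
  subset of it. The integral is that of an integrable function because its total over \<open>Y\<close> is 1.
\<close>

lemma ennreal_obs_density:
  assumes t: "t \<ge> 1" and B: "B \<in> sets (borel_on Y)" and x: "x \<in> X"
  shows "ennreal (LINT y:B|lborel. g t y x) = obs_prob t B x"
proof -
  have BY: "B \<subseteq> Y" and [measurable]: "B \<in> sets borel"
    using B Y_borel by (auto simp: sets_restrict_space)
  have Y[measurable]: "Y \<in> sets lborel" using Y_borel by simp
  have "(\<lambda>y. g t y x) \<in> borel_measurable (borel_on Y)"
    using measurable_Pair1[OF g_measurable[OF t], of x] x by (simp add: space_state)
  then have "(\<lambda>y. indicator Y y *\<^sub>R g t y x) \<in> borel_measurable borel"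
    using Y_borel by (simp add: borel_measurable_restrict_space_iff)
  then have "(\<lambda>y. indicator B y * (indicator Y y *\<^sub>R g t y x)) \<in> borel_measurable lborel"
    by measurable
  then have G: "(\<lambda>y. indicator B y * g t y x) \<in> borel_measurable lborel"
    using BY by (elim measurable_cong[THEN iffD1, rotated]) (auto simp: indicator_def)
  have pos: "0 \<le> indicator B y * g t y x" for y
    using BY g_pos[OF t x, of y] by (auto simp: indicator_def)
  have eq: "(\<integral>\<^sup>+y. ennreal (indicator B y * g t y x) \<partial>lborel) = obs_prob t B x"
    unfolding obs_prob_def using BY Y
    by (subst nn_integral_restrict_space) (auto simp: indicator_def intro!: nn_integral_cong)
  have "obs_prob t B x \<le> (\<integral>\<^sup>+y. ennreal (g t y x) \<partial>lborel_Y)"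
    unfolding obs_prob_def by (intro nn_integral_mono) (auto simp: indicator_def)
  then have "obs_prob t B x < \<infinity>" using g_density[OF t x] by (simp add: le_less_trans)
  then have "integrable lborel (\<lambda>y. indicator B y * g t y x)"
    using G pos eq by (intro integrableI_nonneg) auto
  from nn_integral_eq_integral[OF this] pos eq show ?thesis
    by (simp add: set_lebesgue_integral_def)
qed

lemma obs_density_nonneg:
  assumes t: "t \<ge> 1" and B: "B \<in> sets (borel_on Y)" and x: "x \<in> X"
  shows "0 \<le> (LINT y:B|lborel. g t y x)"
  unfolding set_lebesgue_integral_def using B g_pos[OF t x]
  by (intro Bochner_Integration.integral_nonneg) (auto simp: indicator_def sets_restrict_space less_imp_le)

lemma filtering_cong:
  "(\<And>s. s \<in> {1..n} \<Longrightarrow> y s = y' s) \<Longrightarrow> filtering pi0 K g y n = filtering pi0 K g y' n"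
  by (induction n) auto

lemma pi0_subprob: "pi0 \<in> space (subprob_algebra (borel_on X))"
  using pi0_prob by (simp add: space_prob_algebra space_subprob_algebra prob_space_imp_subprob_space)

lemma likelihood_measurable:
  assumes t: "t \<ge> 1" and y: "y \<in> N \<rightarrow>\<^sub>M borel_on Y"
  shows "(\<lambda>(w, x). ennreal (g t (y w) x)) \<in> borel_measurable (N \<Otimes>\<^sub>M borel_on X)"
proof -
  have "(\<lambda>p. (y (fst p), snd p)) \<in> N \<Otimes>\<^sub>M borel_on X \<rightarrow>\<^sub>M borel_on Y \<Otimes>\<^sub>M borel_on X"
    by (intro measurable_Pair measurable_compose[OF measurable_fst y] measurable_snd)
  from measurable_compose[OF this g_measurable[OF t]] show ?thesis
    by (simp add: split_beta')
qed

text \<open>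
  The observation sequence may depend measurably on a point of any measurable space. Taking that space
  to be the space of finite observation sequences turns the filter into a kernel on sequences, which
  can be integrated against their law.
\<close>

lemma filtering_measurable:
  assumes "\<And>s. s \<in> {1..n} \<Longrightarrow> (\<lambda>w. y w s) \<in> N \<rightarrow>\<^sub>M borel_on Y"
  shows "(\<lambda>w. filtering pi0 K g (y w) n) \<in> N \<rightarrow>\<^sub>M subprob_algebra (borel_on X)"
  using assms
proof (induction n)
  case 0
  then show ?case using pi0_subprob by simp
next
  case (Suc n)
  have "(\<lambda>w. filtering pi0 K g (y w) n) \<in> N \<rightarrow>\<^sub>M subprob_algebra (borel_on X)"
    using Suc by auto
  then have "(\<lambda>w. kernel_push (K (Suc n)) (filtering pi0 K g (y w) n))
      \<in> N \<rightarrow>\<^sub>M subprob_algebra (borel_on X)"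
    unfolding kernel_push_def using kernel_measurable by (rule measurable_bind2)
  from bayes_update_measurable[OF this likelihood_measurable[OF _ Suc.prems]]
  show ?case by simp
qed

lemma predictor_measurable:
  assumes "\<And>s. s \<in> {1..n} \<Longrightarrow> (\<lambda>w. y w s) \<in> N \<rightarrow>\<^sub>M borel_on Y"
  shows "(\<lambda>w. predictor (y w) n) \<in> N \<rightarrow>\<^sub>M subprob_algebra (borel_on X)"
  unfolding predictor_def kernel_push_def using filtering_measurable[OF assms] kernel_measurable
  by (rule measurable_bind2)

lemma emeasure_filtering_Suc:
  assumes y: "y (Suc n) \<in> Y" and pred: "predictor y n \<in> space (subprob_algebra (borel_on X))"
    and A: "A \<in> sets (borel_on X)"
  shows "emeasure (filtering pi0 K g y (Suc n)) A
    = (\<integral>\<^sup>+x. ennreal (g (Suc n) (y (Suc n)) x) * indicator A x \<partial>predictor y n)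
      / (\<integral>\<^sup>+x. ennreal (g (Suc n) (y (Suc n)) x) \<partial>predictor y n)"
proof -
  have s: "sets (predictor y n) = sets (borel_on X)"
    using pred by (simp add: space_subprob_algebra)
  have "(\<lambda>x. g (Suc n) (y (Suc n)) x) \<in> borel_measurable (borel_on X)"
    using measurable_Pair2[OF g_measurable[of "Suc n"], of "y (Suc n)"] y
    by (simp add: space_restrict_space)
  then have "(\<lambda>x. ennreal (g (Suc n) (y (Suc n)) x)) \<in> borel_measurable (predictor y n)"
    by (simp add: measurable_cong_sets[OF s refl])
  then show ?thesis
    using A s by (simp add: predictor_def[symmetric] emeasure_bayes_update)
qed

end

section \<open>Integrals over observation events and over the next state\<close>

context state_space_process
begin
abbreviation all_states :: "'w measure" where
  "all_states \<equiv> sigma_generated M UNIV State (borel_on X)"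

definition past_obs :: "nat \<Rightarrow> 'w \<Rightarrow> nat \<Rightarrow> 'y" where
  "past_obs n w = (\<lambda>s\<in>{1..n}. Obs s w)"

lemma past_obs_measurable[measurable]: "past_obs n \<in> M \<rightarrow>\<^sub>M obs_space n"
  unfolding past_obs_def[abs_def] using Obs_measurable by (intro measurable_restrict) auto

declare State_measurable[measurable]

lemma State_in: "w \<in> space M \<Longrightarrow> State t w \<in> X"
  using measurable_space[OF State_measurable] by (simp add: space_state)

lemma indicator_past_obs:
  assumes "w \<in> space M"
  shows "indicator (PiE {1..n} B) (past_obs n w)
    = indicator {w \<in> space M. \<forall>j\<in>{1..n}. Obs j w \<in> B j} w"
  using assms by (auto simp: indicator_def past_obs_def PiE_iff)

lemma obs_event_measurable:
  assumes "finite J" "J \<subseteq> {1..}" "\<And>j. j \<in> J \<Longrightarrow> B j \<in> sets (borel_on Y)"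
  shows "{w \<in> space M. \<forall>j\<in>J. Obs j w \<in> B j} \<in> sets M"
proof (intro sets.sets_Collect_finite_All assms(1))
  fix j assume j: "j \<in> J"
  then have [measurable]: "Obs j \<in> M \<rightarrow>\<^sub>M borel_on Y" "B j \<in> sets (borel_on Y)"
    using assms Obs_measurable by auto
  show "{w \<in> space M. Obs j w \<in> B j} \<in> sets M" by measurable
qed

text \<open>
  Under an integral against a function of the state process, an event of finitely many observations may
  be exchanged for the product of its conditional probabilities, and conversely.
\<close>

lemma nn_integral_obs_event:
  assumes J: "finite J" "J \<subseteq> {1..}" and B: "\<And>j. j \<in> J \<Longrightarrow> B j \<in> sets (borel_on Y)"
    and f: "f \<in> borel_measurable all_states"
  shows "(\<integral>\<^sup>+w. f w * indicator {w \<in> space M. \<forall>j\<in>J. Obs j w \<in> B j} w \<partial>M)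
    = (\<integral>\<^sup>+w. f w * (\<Prod>j\<in>J. obs_prob j (B j) (State j w)) \<partial>M)"
proof -
  have sub: "subalgebra M all_states"
    by (rule subalgebra_sigma_generated) (rule State_measurable)
  have indep: "AE w in M. cond_pr M all_states (\<lambda>w. \<forall>j\<in>J. Obs j w \<in> B j) w
      = (\<Prod>j\<in>J. cond_pr M all_states (\<lambda>w. Obs j w \<in> B j) w)"
    using J B by (rule obs_cond_indep)
  have single: "AE w in M. \<forall>j\<in>J. cond_pr M all_states (\<lambda>w. Obs j w \<in> B j) w
      = (LINT y:B j|lborel. g j y (State j w))"
    using J B by (intro AE_finite_allI obs_density) auto
  have "AE w in M. cond_pr M all_states (\<lambda>w. \<forall>j\<in>J. Obs j w \<in> B j) w
      = (\<Prod>j\<in>J. LINT y:B j|lborel. g j y (State j w))"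
    using indep single by eventually_elim simp
  then have "(\<integral>\<^sup>+w. f w * indicator {w \<in> space M. \<forall>j\<in>J. Obs j w \<in> B j} w \<partial>M)
      = (\<integral>\<^sup>+w. f w * ennreal (\<Prod>j\<in>J. LINT y:B j|lborel. g j y (State j w)) \<partial>M)"
    by (intro nn_integral_cond_pr[OF sub] obs_event_measurable J B f)
  also have "\<dots> = (\<integral>\<^sup>+w. f w * (\<Prod>j\<in>J. obs_prob j (B j) (State j w)) \<partial>M)"
  proof (rule nn_integral_cong)
    fix w assume w: "w \<in> space M"
    have "ennreal (\<Prod>j\<in>J. LINT y:B j|lborel. g j y (State j w))
        = (\<Prod>j\<in>J. ennreal (LINT y:B j|lborel. g j y (State j w)))"
      using J B State_in[OF w] by (intro prod_ennreal[symmetric] obs_density_nonneg) auto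
    also have "\<dots> = (\<Prod>j\<in>J. obs_prob j (B j) (State j w))"
      using J B State_in[OF w] by (intro prod.cong refl ennreal_obs_density) auto
    finally show "f w * ennreal (\<Prod>j\<in>J. LINT y:B j|lborel. g j y (State j w))
        = f w * (\<Prod>j\<in>J. obs_prob j (B j) (State j w))" by simp
  qed
  finally show ?thesis .
qed

lemma nn_integral_markov:
  assumes A: "A \<in> sets (borel_on X)"
    and f: "f \<in> borel_measurable (sigma_generated M {..<Suc n} State (borel_on X))"
  shows "(\<integral>\<^sup>+w. f w * indicator A (State (Suc n) w) \<partial>M)
    = (\<integral>\<^sup>+w. f w * emeasure (K (Suc n) (State n w)) A \<partial>M)"
proof -
  have E: "{w \<in> space M. State (Suc n) w \<in> A} \<in> sets M"
    using A by measurable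
  have sub: "subalgebra M (sigma_generated M {..<Suc n} State (borel_on X))"
    by (rule subalgebra_sigma_generated) (rule State_measurable)
  have "(\<integral>\<^sup>+w. f w * indicator A (State (Suc n) w) \<partial>M)
      = (\<integral>\<^sup>+w. f w * indicator {w \<in> space M. State (Suc n) w \<in> A} w \<partial>M)"
    by (intro nn_integral_cong) (simp add: indicator_def)
  also have "\<dots> = (\<integral>\<^sup>+w. f w * ennreal (measure (K (Suc n) (State n w)) A) \<partial>M)"
    using nn_integral_cond_pr[OF sub E markov[OF _ A] f] by simp
  also have "\<dots> = (\<integral>\<^sup>+w. f w * emeasure (K (Suc n) (State n w)) A \<partial>M)"
  proof (rule nn_integral_cong)
    fix w assume w: "w \<in> space M"
    interpret k: subprob_space "K (Suc n) (State n w)"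
      using State_in[OF w] by (intro subprob_space_kernel[OF kernel_measurable]) (simp add: space_state)
    show "f w * ennreal (measure (K (Suc n) (State n w)) A)
        = f w * emeasure (K (Suc n) (State n w)) A"
      by (simp add: k.emeasure_eq_measure)
  qed
  finally show ?thesis .
qed

lemma state_function_measurable:
  assumes "s \<in> I" "f \<in> borel_measurable (borel_on X)"
  shows "(\<lambda>w. f (State s w)) \<in> borel_measurable (sigma_generated M I State (borel_on X))"
  using measurable_compose[OF measurable_sigma_generated[OF assms(1) State_measurable] assms(2)] .

lemma predictor_past_obs_measurable: "(\<lambda>v. predictor v n) \<in> obs_space n \<rightarrow>\<^sub>M subprob_algebra (borel_on X)"
  by (intro predictor_measurable measurable_component_singleton)

lemma filtering_past_obs_measurable:
  "(\<lambda>v. filtering pi0 K g v n) \<in> obs_space n \<rightarrow>\<^sub>M subprob_algebra (borel_on X)"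
  by (intro filtering_measurable measurable_component_singleton)

section \<open>Prediction\<close>

text \<open>
  The filter is a version of the conditional law of the current state given the past observations.
  Both sides are integrals over the underlying space, so the law of the observations stays implicit.
\<close>

definition filter_correct :: "nat \<Rightarrow> bool" where
  "filter_correct n \<longleftrightarrow> (\<forall>C \<in> sets (obs_space n). \<forall>A \<in> sets (borel_on X).
    (\<integral>\<^sup>+w. indicator C (past_obs n w) * indicator A (State n w) \<partial>M)
      = (\<integral>\<^sup>+w. indicator C (past_obs n w) * emeasure (filtering pi0 K g (past_obs n w) n) A \<partial>M))"

text \<open>
  At time 0 there are no observations: the past is a constant, so that conditioning has no effect.
\<close>

lemma filter_correct_0: "filter_correct 0"
  unfolding filter_correct_def
proof (intro ballI)
  fix C A assume "C \<in> sets (obs_space 0)" and A[measurable]: "A \<in> sets (borel_on X)"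
  have "(\<integral>\<^sup>+w. indicator A (State 0 w) \<partial>M) = emeasure (distr M (borel_on X) (State 0)) A"
    using A by (subst emeasure_distr) (auto simp: indicator_def intro!: nn_integral_cong simp flip: nn_integral_indicator)
  then show "(\<integral>\<^sup>+w. indicator C (past_obs 0 w) * indicator A (State 0 w) \<partial>M)
      = (\<integral>\<^sup>+w. indicator C (past_obs 0 w) * emeasure (filtering pi0 K g (past_obs 0 w) 0) A \<partial>M)"
    using A initial_law by (simp add: past_obs_def restrict_def nn_integral_cmult emeasure_space_1)
qed

lemma rectangle_sets:
  assumes "\<And>j. j \<in> {1..n} \<Longrightarrow> B j \<in> sets (borel_on Y)"
  shows "PiE {1..n} B \<in> sets (obs_space n)"
  using assms by (intro sets_PiM_I_finite) auto

text \<open>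
  The Markov property conditions on the past states alone, without the observations. The past
  observations are first replaced by functions of the past states, by conditional independence, and
  restored after the Markov property has been applied.
\<close>

lemma predictor_correct:
  assumes correct: "filter_correct n"
    and B: "\<And>j. j \<in> {1..n} \<Longrightarrow> B j \<in> sets (borel_on Y)"
    and f: "f \<in> borel_measurable (borel_on X)"
  shows "(\<integral>\<^sup>+w. indicator (PiE {1..n} B) (past_obs n w) * f (State (Suc n) w) \<partial>M)
    = (\<integral>\<^sup>+w. indicator (PiE {1..n} B) (past_obs n w) * (\<integral>\<^sup>+x. f x \<partial>predictor (past_obs n w) n) \<partial>M)"
proof (rule nn_integral_disintegration[OF past_obs_measurable State_measurable
      predictor_past_obs_measurable rectangle_sets[OF B] _ f])
  let ?C = "PiE {1..n} B" and ?E = "{w \<in> space M. \<forall>j\<in>{1..n}. Obs j w \<in> B j}"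
  let ?q = "\<lambda>w. \<Prod>j\<in>{1..n}. obs_prob j (B j) (State j w)"
  fix A assume A: "A \<in> sets (borel_on X)"
  have KA: "(\<lambda>x. emeasure (K (Suc n) x) A) \<in> borel_measurable (borel_on X)"
    by (rule measurable_emeasure_kernel[OF kernel_measurable A])
  have q: "?q \<in> borel_measurable (sigma_generated M {..<Suc n} State (borel_on X))"
    using B by (intro borel_measurable_prod_ennreal state_function_measurable obs_prob_measurable) auto
  have obs: "(\<integral>\<^sup>+w. f (State s w) * indicator ?E w \<partial>M) = (\<integral>\<^sup>+w. f (State s w) * ?q w \<partial>M)"
    if "f \<in> borel_measurable (borel_on X)" for f s
    using that B by (intro nn_integral_obs_event state_function_measurable) auto
  have "(\<integral>\<^sup>+w. indicator ?C (past_obs n w) * indicator A (State (Suc n) w) \<partial>M)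
      = (\<integral>\<^sup>+w. indicator A (State (Suc n) w) * indicator ?E w \<partial>M)"
    by (intro nn_integral_cong) (simp only: indicator_past_obs mult.commute)
  also have "\<dots> = (\<integral>\<^sup>+w. indicator A (State (Suc n) w) * ?q w \<partial>M)"
    using A by (intro obs) simp
  also have "\<dots> = (\<integral>\<^sup>+w. ?q w * emeasure (K (Suc n) (State n w)) A \<partial>M)"
    using nn_integral_markov[OF A q] by (simp add: mult.commute)
  also have "\<dots> = (\<integral>\<^sup>+w. emeasure (K (Suc n) (State n w)) A * indicator ?E w \<partial>M)"
    using obs[OF KA] by (simp add: mult.commute)
  also have "\<dots> = (\<integral>\<^sup>+w. indicator ?C (past_obs n w) * emeasure (K (Suc n) (State n w)) A \<partial>M)"
    by (intro nn_integral_cong) (simp only: indicator_past_obs mult.commute)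
  also have "\<dots> = (\<integral>\<^sup>+w. indicator ?C (past_obs n w)
      * (\<integral>\<^sup>+x. emeasure (K (Suc n) x) A \<partial>filtering pi0 K g (past_obs n w) n) \<partial>M)"
    using correct rectangle_sets[OF B] unfolding filter_correct_def
    by (intro nn_integral_disintegration[OF past_obs_measurable State_measurable
      filtering_past_obs_measurable rectangle_sets[OF B] _ KA]) auto
  also have "\<dots> = (\<integral>\<^sup>+w. indicator ?C (past_obs n w) * emeasure (predictor (past_obs n w) n) A \<partial>M)"
  proof (intro nn_integral_cong arg_cong2[where f = "(*)"] refl)
    fix w assume w: "w \<in> space M"
    have v: "past_obs n w \<in> space (obs_space n)"
      using measurable_space[OF past_obs_measurable w] .
    have s: "sets (filtering pi0 K g (past_obs n w) n) = sets (borel_on X)"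
      by (rule sets_kernel[OF filtering_past_obs_measurable v])
    have ne: "space (borel_on X) \<noteq> {}" using State_in[OF w] by (auto simp: space_state)
    show "(\<integral>\<^sup>+x. emeasure (K (Suc n) x) A \<partial>filtering pi0 K g (past_obs n w) n)
        = emeasure (predictor (past_obs n w) n) A"
      unfolding predictor_def using emeasure_kernel_push[OF s ne K_kernel A] by simp
  qed
  finally show "(\<integral>\<^sup>+w. indicator ?C (past_obs n w) * indicator A (State (Suc n) w) \<partial>M)
      = (\<integral>\<^sup>+w. indicator ?C (past_obs n w) * emeasure (predictor (past_obs n w) n) A \<partial>M)" .
qed

section \<open>Joint law of the observations and the state\<close>

text \<open>
  The reference measure for the joint law of the first \<open>n\<close> observations and the next one.
\<close>

definition past_and_lebesgue :: "nat \<Rightarrow> ((nat \<Rightarrow> 'y) \<times> 'y) measure" where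
  "past_and_lebesgue n = distr M (obs_space n) (past_obs n) \<Otimes>\<^sub>M lborel_Y"

text \<open>
  For past observations \<open>v\<close> and a next observation \<open>y\<close>, this is the numerator of Bayes' rule for the
  event that the next state lies in \<open>A\<close>; for \<open>A = X\<close> it is the normalising constant.
\<close>

definition joint_density :: "nat \<Rightarrow> 'x set \<Rightarrow> (nat \<Rightarrow> 'y) \<times> 'y \<Rightarrow> ennreal" where
  "joint_density n A = (\<lambda>(v, y). \<integral>\<^sup>+x. ennreal (g (Suc n) y x) * indicator A x \<partial>predictor v n)"

lemma sets_past_and_lebesgue: "sets (past_and_lebesgue n) = sets (obs_space n \<Otimes>\<^sub>M borel_on Y)"
  unfolding past_and_lebesgue_def by (intro sets_pair_measure_cong) (simp_all add: sets_lborel_Y)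

lemma joint_density_measurable:
  assumes A: "A \<in> sets (borel_on X)"
  shows "joint_density n A \<in> borel_measurable (obs_space n \<Otimes>\<^sub>M borel_on Y)"
proof -
  let ?N = "obs_space n \<Otimes>\<^sub>M borel_on Y"
  have "(\<lambda>p. (indicator A (snd p) :: ennreal)) \<in> borel_measurable (?N \<Otimes>\<^sub>M borel_on X)"
    using A by measurable
  then have "(\<lambda>(w, x). ennreal (g (Suc n) (snd w) x) * indicator A x) \<in> borel_measurable (?N \<Otimes>\<^sub>M borel_on X)"
    using likelihood_measurable[of "Suc n" snd ?N] by (auto simp: split_beta')
  moreover have "(\<lambda>w. predictor (fst w) n) \<in> ?N \<rightarrow>\<^sub>M subprob_algebra (borel_on X)"
    using measurable_compose[OF measurable_fst predictor_past_obs_measurable] .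
  ultimately have "(\<lambda>w. \<integral>\<^sup>+x. ennreal (g (Suc n) (snd w) x) * indicator A x \<partial>predictor (fst w) n)
      \<in> borel_measurable ?N"
    by (rule nn_integral_measurable_subprob_algebra2)
  then show ?thesis by (simp only: joint_density_def split_beta')
qed

lemma extend_obs_measurable:
  "(\<lambda>(v, y). v(Suc n := y)) \<in> obs_space n \<Otimes>\<^sub>M borel_on Y \<rightarrow>\<^sub>M obs_space (Suc n)"
proof -
  have "insert (Suc n) {1..n} = {1..Suc n}" by auto
  then show ?thesis
    using measurable_add_dim[of "Suc n" "{1..n}" "\<lambda>_. borel_on Y :: 'y measure"] by simp
qed

text \<open>
  Fubini for the predictor and Lebesgue measure: the probability that the new state lies in \<open>A\<close> and
  the new observation in \<open>B\<close>, computed in either order.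
\<close>

lemma predictor_obs_prob:
  assumes v: "v \<in> space (obs_space n)" and A: "A \<in> sets (borel_on X)" and B: "B \<in> sets (borel_on Y)"
  shows "(\<integral>\<^sup>+x. indicator A x * obs_prob (Suc n) B x \<partial>predictor v n)
    = (\<integral>\<^sup>+y. indicator B y * joint_density n A (v, y) \<partial>lborel_Y)"
proof -
  have s: "sets (predictor v n) = sets (borel_on X)"
    by (rule sets_kernel[OF predictor_past_obs_measurable v])
  interpret P: sigma_finite_measure "predictor v n"
    by (intro subprob_space_imp_sigma_finite subprob_space_kernel[OF predictor_past_obs_measurable v])
  interpret L: sigma_finite_measure lborel_Y by (rule sigma_finite_lborel_Y)
  interpret PL: pair_sigma_finite lborel_Y "predictor v n" ..
  have gm: "(\<lambda>(y, x). g (Suc n) y x) \<in> borel_measurable (lborel_Y \<Otimes>\<^sub>M predictor v n)"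
    using g_measurable[of "Suc n"]
    by (simp cong: measurable_cong_sets sets_pair_measure_cong add: sets_lborel_Y s)
  have [measurable]: "A \<in> sets (predictor v n)" "B \<in> sets lborel_Y"
    using A B s sets_lborel_Y by auto
  have F: "(\<lambda>(y, x). indicator A x * (ennreal (g (Suc n) y x) * indicator B y))
      \<in> borel_measurable (lborel_Y \<Otimes>\<^sub>M predictor v n)"
    using gm by measurable
  have g1: "(\<lambda>y. g (Suc n) y x) \<in> borel_measurable lborel_Y" if "x \<in> space (predictor v n)" for x
    using measurable_Pair1[OF gm that] by simp
  have g2: "(\<lambda>x. g (Suc n) y x) \<in> borel_measurable (predictor v n)" if "y \<in> space lborel_Y" for y
    using measurable_Pair2[OF gm that] by simp
  have "(\<integral>\<^sup>+x. indicator A x * obs_prob (Suc n) B x \<partial>predictor v n)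
      = (\<integral>\<^sup>+x. \<integral>\<^sup>+y. indicator A x * (ennreal (g (Suc n) y x) * indicator B y) \<partial>lborel_Y \<partial>predictor v n)"
    unfolding obs_prob_def using g1 by (intro nn_integral_cong nn_integral_cmult[symmetric]) auto
  also have "\<dots> = (\<integral>\<^sup>+y. \<integral>\<^sup>+x. indicator A x * (ennreal (g (Suc n) y x) * indicator B y) \<partial>predictor v n \<partial>lborel_Y)"
    by (rule PL.Fubini'[OF F])
  also have "\<dots> = (\<integral>\<^sup>+y. \<integral>\<^sup>+x. indicator B y * (ennreal (g (Suc n) y x) * indicator A x) \<partial>predictor v n \<partial>lborel_Y)"
    by (simp add: mult_ac)
  also have "\<dots> = (\<integral>\<^sup>+y. indicator B y * joint_density n A (v, y) \<partial>lborel_Y)"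
    unfolding joint_density_def using g2 by (intro nn_integral_cong) (auto intro!: nn_integral_cmult)
  finally show ?thesis .
qed

text \<open>
  Conditional independence is used twice: with all observations to pull out the factor of the new one,
  then with the first \<open>n\<close> observations to restore the event of the past. What remains is a function of
  the new state over an event of the past, to which the prediction step applies.
\<close>

lemma joint_density_correct_rectangle:
  assumes correct: "filter_correct n" and A: "A \<in> sets (borel_on X)"
    and B: "\<And>j. j \<in> {1..Suc n} \<Longrightarrow> B j \<in> sets (borel_on Y)"
  shows "(\<integral>\<^sup>+w. indicator (PiE {1..Suc n} B) (past_obs (Suc n) w) * indicator A (State (Suc n) w) \<partial>M)
    = (\<integral>\<^sup>+(v, y). indicator (PiE {1..Suc n} B) (v(Suc n := y)) * joint_density n A (v, y) \<partial>past_and_lebesgue n)"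
proof -
  let ?C = "PiE {1..n} B" and ?C' = "PiE {1..Suc n} B"
  let ?E = "\<lambda>n. {w \<in> space M. \<forall>j\<in>{1..n}. Obs j w \<in> B j}"
  let ?q = "obs_prob (Suc n) (B (Suc n))"
  let ?f = "\<lambda>x. indicator A x * ?q x"
  let ?S = "\<lambda>w. State (Suc n) w"
  have BS[measurable]: "B (Suc n) \<in> sets (borel_on Y)" using B by simp
  have Bn: "\<And>j. j \<in> {1..n} \<Longrightarrow> B j \<in> sets (borel_on Y)" using B by simp
  note [measurable] = A obs_prob_measurable[OF _ BS, of "Suc n", simplified] rectangle_sets[OF Bn]
  have f: "?f \<in> borel_measurable (borel_on X)" by measurable
  have "(\<integral>\<^sup>+w. indicator ?C' (past_obs (Suc n) w) * indicator A (?S w) \<partial>M)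
      = (\<integral>\<^sup>+w. indicator A (?S w) * indicator (?E (Suc n)) w \<partial>M)"
    by (intro nn_integral_cong) (simp only: indicator_past_obs mult.commute)
  also have "\<dots> = (\<integral>\<^sup>+w. indicator A (?S w) * (\<Prod>j\<in>{1..Suc n}. obs_prob j (B j) (State j w)) \<partial>M)"
    using B A by (intro nn_integral_obs_event state_function_measurable) auto
  also have "\<dots> = (\<integral>\<^sup>+w. ?f (?S w) * (\<Prod>j\<in>{1..n}. obs_prob j (B j) (State j w)) \<partial>M)"
    by (simp add: mult_ac)
  also have "\<dots> = (\<integral>\<^sup>+w. ?f (?S w) * indicator (?E n) w \<partial>M)"
    using Bn state_function_measurable[OF UNIV_I f]
    by (intro nn_integral_obs_event[symmetric]) auto
  also have "\<dots> = (\<integral>\<^sup>+w. indicator ?C (past_obs n w) * ?f (?S w) \<partial>M)"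
    by (intro nn_integral_cong) (simp only: indicator_past_obs mult.commute)
  also have "\<dots> = (\<integral>\<^sup>+w. indicator ?C (past_obs n w) * (\<integral>\<^sup>+x. ?f x \<partial>predictor (past_obs n w) n) \<partial>M)"
    by (rule predictor_correct[OF correct Bn f])
  also have "\<dots> = (\<integral>\<^sup>+v. indicator ?C v * (\<integral>\<^sup>+x. ?f x \<partial>predictor v n) \<partial>distr M (obs_space n) (past_obs n))"
  proof (rule nn_integral_distr[symmetric])
    have "(\<lambda>v. indicator ?C v * (\<integral>\<^sup>+x. ?f x \<partial>predictor v n)) \<in> borel_measurable (obs_space n)"
      by (intro borel_measurable_times_ennreal borel_measurable_indicator rectangle_sets[OF Bn]
          measurable_compose[OF predictor_past_obs_measurable nn_integral_measurable_subprob_algebra[OF f]])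
    then show "(\<lambda>v. indicator ?C v * (\<integral>\<^sup>+x. ?f x \<partial>predictor v n))
        \<in> borel_measurable (distr M (obs_space n) (past_obs n))"
      by (simp only: measurable_distr_eq1)
  qed (rule past_obs_measurable)
  also have "\<dots> = (\<integral>\<^sup>+v. \<integral>\<^sup>+y. indicator ?C v * (indicator (B (Suc n)) y * joint_density n A (v, y)) \<partial>lborel_Y
      \<partial>distr M (obs_space n) (past_obs n))"
  proof (rule nn_integral_cong)
    fix v assume "v \<in> space (distr M (obs_space n) (past_obs n))"
    then have v: "v \<in> space (obs_space n)" by simp
    have "(\<lambda>y. joint_density n A (v, y)) \<in> borel_measurable lborel_Y"
      using measurable_Pair2[OF joint_density_measurable[OF A] v]
      by (simp add: measurable_cong_sets[OF sets_lborel_Y refl])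
    moreover have "B (Suc n) \<in> sets lborel_Y" using BS sets_lborel_Y by simp
    ultimately show "indicator ?C v * (\<integral>\<^sup>+x. ?f x \<partial>predictor v n)
        = (\<integral>\<^sup>+y. indicator ?C v * (indicator (B (Suc n)) y * joint_density n A (v, y)) \<partial>lborel_Y)"
      unfolding predictor_obs_prob[OF v A BS] by (intro nn_integral_cmult[symmetric]) auto
  qed
  also have "\<dots> = (\<integral>\<^sup>+v. \<integral>\<^sup>+y. indicator ?C' (v(Suc n := y)) * joint_density n A (v, y) \<partial>lborel_Y
      \<partial>distr M (obs_space n) (past_obs n))"
  proof (intro nn_integral_cong)
    fix v y assume "v \<in> space (distr M (obs_space n) (past_obs n))"
    then have "v \<in> extensional {1..n}" by (simp add: space_PiM PiE_def)
    then have "v(Suc n := y) \<in> ?C' \<longleftrightarrow> v \<in> ?C \<and> y \<in> B (Suc n)"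
      by (auto simp: PiE_iff extensional_def Ball_def)
    then show "indicator ?C v * (indicator (B (Suc n)) y * joint_density n A (v, y))
        = indicator ?C' (v(Suc n := y)) * joint_density n A (v, y)"
      by (simp only: indicator_def of_bool_conj mult.assoc)
  qed
  also have "\<dots> = (\<integral>\<^sup>+(v, y). indicator ?C' (v(Suc n := y)) * joint_density n A (v, y) \<partial>past_and_lebesgue n)"
  proof -
    interpret sigma_finite_measure lborel_Y by (rule sigma_finite_lborel_Y)
    have "(\<lambda>p. indicator ?C' ((\<lambda>(v, y). v(Suc n := y)) p) * joint_density n A p)
        \<in> borel_measurable (obs_space n \<Otimes>\<^sub>M borel_on Y)"
      using rectangle_sets[OF B] joint_density_measurable[OF A, of n]
        measurable_compose[OF extend_obs_measurable borel_measurable_indicator[OF rectangle_sets[OF B]]]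
      by (intro borel_measurable_times_ennreal) auto
    then have "(\<lambda>(v, y). indicator ?C' (v(Suc n := y)) * joint_density n A (v, y))
        \<in> borel_measurable (past_and_lebesgue n)"
      by (simp add: measurable_cong_sets[OF sets_past_and_lebesgue refl] split_beta')
    from nn_integral_fst[OF this[unfolded past_and_lebesgue_def]] show ?thesis
      by (simp add: past_and_lebesgue_def)
  qed
  finally show ?thesis .
qed

text \<open>
  Rectangles determine finite measures on the product space, so the formula extends to all events, and
  then to all functions of the observations.
\<close>

lemma joint_density_correct:
  assumes correct: "filter_correct n" and A: "A \<in> sets (borel_on X)"
    and F: "F \<in> borel_measurable (obs_space (Suc n))"
  shows "(\<integral>\<^sup>+w. indicator A (State (Suc n) w) * F (past_obs (Suc n) w) \<partial>M)
    = (\<integral>\<^sup>+p. joint_density n A p * F ((fst p)(Suc n := snd p)) \<partial>past_and_lebesgue n)"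
proof -
  let ?V = "obs_space (Suc n)" and ?I = "{1..Suc n}"
  let ?DM = "density M (\<lambda>w. indicator A (State (Suc n) w))"
  let ?DR = "density (past_and_lebesgue n) (joint_density n A)"
  let ?P = "distr ?DM ?V (past_obs (Suc n))"
  let ?u = "\<lambda>p. (fst p)(Suc n := snd p)"
  let ?Q = "distr ?DR ?V ?u"
  note [measurable] = A
  have SA: "(\<lambda>w. indicator A (State (Suc n) w)) \<in> borel_measurable M"
    by measurable
  have past: "past_obs (Suc n) \<in> ?DM \<rightarrow>\<^sub>M ?V"
    using past_obs_measurable by (simp only: measurable_density_eq1)
  have u: "?u \<in> past_and_lebesgue n \<rightarrow>\<^sub>M ?V"
    using extend_obs_measurable[of n]
    by (simp only: measurable_cong_sets[OF sets_past_and_lebesgue refl] split_beta')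
  have uD: "?u \<in> ?DR \<rightarrow>\<^sub>M ?V"
    using u by (simp only: measurable_density_eq1)
  have jd: "joint_density n A \<in> borel_measurable (past_and_lebesgue n)"
    using joint_density_measurable[OF A]
    by (simp only: measurable_cong_sets[OF sets_past_and_lebesgue refl])
  have intP: "(\<integral>\<^sup>+v. G v \<partial>?P) = (\<integral>\<^sup>+w. indicator A (State (Suc n) w) * G (past_obs (Suc n) w) \<partial>M)"
    if G: "G \<in> borel_measurable ?V" for G
    using G measurable_compose[OF past_obs_measurable G] SA
    by (subst nn_integral_distr[OF past]) (auto simp: nn_integral_density simp del: One_nat_def)
  have intQ: "(\<integral>\<^sup>+v. G v \<partial>?Q) = (\<integral>\<^sup>+p. joint_density n A p * G (?u p) \<partial>past_and_lebesgue n)"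
    if G: "G \<in> borel_measurable ?V" for G
    using G measurable_compose[OF u G] jd
    by (subst nn_integral_distr[OF uD]) (auto simp: nn_integral_density simp del: One_nat_def)
  have "?P = ?Q"
  proof (rule measure_eqI_PiM_finite)
    fix B :: "nat \<Rightarrow> 'y set" assume B: "\<And>i. i \<in> ?I \<Longrightarrow> B i \<in> sets (borel_on Y)"
    let ?C = "PiE ?I B"
    have C: "?C \<in> sets ?V" by (rule rectangle_sets[OF B])
    have "emeasure ?P ?C = (\<integral>\<^sup>+v. indicator ?C v \<partial>?P)" using C by simp
    also have "\<dots> = (\<integral>\<^sup>+w. indicator ?C (past_obs (Suc n) w) * indicator A (State (Suc n) w) \<partial>M)"
      using C by (subst intP) (auto simp: mult.commute simp del: One_nat_def)
    also have "\<dots> = (\<integral>\<^sup>+p. joint_density n A p * indicator ?C (?u p) \<partial>past_and_lebesgue n)"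
      using joint_density_correct_rectangle[OF correct A B]
      by (simp only: split_beta' prod.collapse mult.commute)
    also have "\<dots> = (\<integral>\<^sup>+v. indicator ?C v \<partial>?Q)"
      using C by (subst intQ) auto
    also have "\<dots> = emeasure ?Q ?C" using C by simp
    finally show "emeasure ?P ?C = emeasure ?Q ?C" .
  next
    show "range (\<lambda>_::nat. space ?V) \<subseteq> prod_algebra ?I (\<lambda>_. borel_on Y)"
      using space_in_prod_algebra[of ?I "\<lambda>_. borel_on Y :: 'y measure"] by (auto simp: space_PiM)
    have "emeasure ?P (space ?V) = (\<integral>\<^sup>+v. indicator (space ?V) v \<partial>?P)" by simp
    also have "\<dots> = (\<integral>\<^sup>+w. indicator A (State (Suc n) w) * indicator (space ?V) (past_obs (Suc n) w) \<partial>M)"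
      by (rule intP) simp
    also have "\<dots> \<le> (\<integral>\<^sup>+w. 1 \<partial>M)"
      by (intro nn_integral_mono) (auto simp: indicator_def)
    finally show "emeasure ?P (space ?V) \<noteq> \<infinity>" by (auto simp: emeasure_space_1 top_unique)
  qed (simp_all del: One_nat_def)
  then show ?thesis using intP[OF F] intQ[OF F] by simp
qed

section \<open>Bayes' rule and the induction\<close>

text \<open>
  The normalising constant is the density of the law of the first \<open>n + 1\<close> observations, hence has
  integral at most 1.
\<close>

lemma likelihood_finite:
  assumes correct: "filter_correct n"
  shows "AE p in past_and_lebesgue n. joint_density n X p \<noteq> \<infinity>"
proof (rule nn_integral_PInf_AE)
  have X: "X \<in> sets (borel_on X)" using sets.top[of "borel_on X"] by (simp only: space_state)
  show "joint_density n X \<in> borel_measurable (past_and_lebesgue n)"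
    using joint_density_measurable[OF X]
    by (simp only: measurable_cong_sets[OF sets_past_and_lebesgue refl])
  have "(\<integral>\<^sup>+p. joint_density n X p \<partial>past_and_lebesgue n) = (\<integral>\<^sup>+w. indicator X (State (Suc n) w) \<partial>M)"
    using joint_density_correct[OF correct X, of "\<lambda>_. 1"] by simp
  also have "\<dots> \<le> (\<integral>\<^sup>+w. 1 \<partial>M)"
    by (intro nn_integral_mono) (auto simp: indicator_def)
  finally show "(\<integral>\<^sup>+p. joint_density n X p \<partial>past_and_lebesgue n) \<noteq> \<infinity>"
    by (auto simp: emeasure_space_1 top_unique)
qed

lemma joint_density_mono: "A \<subseteq> A' \<Longrightarrow> joint_density n A p \<le> joint_density n A' p"
  unfolding joint_density_def by (cases p) (auto intro!: nn_integral_mono simp: indicator_def)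

text \<open>
  The predictor reads only the first \<open>n\<close> observations, so appending the new one leaves it unchanged.
\<close>

lemma bayes_formula:
  assumes v: "v \<in> space (obs_space n)" and y: "y \<in> Y" and A: "A \<in> sets (borel_on X)"
  shows "emeasure (filtering pi0 K g (v(Suc n := y)) (Suc n)) A
    = joint_density n A (v, y) / joint_density n X (v, y)"
proof -
  let ?v = "v(Suc n := y)"
  have pred: "predictor ?v n = predictor v n"
    unfolding predictor_def by (intro arg_cong[where f = "kernel_push _"] filtering_cong) auto
  have k: "predictor v n \<in> space (subprob_algebra (borel_on X))"
    using measurable_space[OF predictor_past_obs_measurable v] .
  then have "space (predictor v n) = X"
    using sets_eq_imp_space_eq[of "predictor v n" "borel_on X"] by (simp add: space_subprob_algebra space_state)
  then have "joint_density n X (v, y) = (\<integral>\<^sup>+x. ennreal (g (Suc n) y x) \<partial>predictor v n)"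
    by (auto simp: joint_density_def intro!: nn_integral_cong)
  then show ?thesis
    using emeasure_filtering_Suc[of ?v n A] y k A by (simp add: pred joint_density_def del: filtering.simps)
qed

lemma filter_correct_Suc:
  assumes correct: "filter_correct n"
  shows "filter_correct (Suc n)"
  unfolding filter_correct_def
proof (intro ballI)
  fix C A assume C: "C \<in> sets (obs_space (Suc n))" and A: "A \<in> sets (borel_on X)"
  have X: "X \<in> sets (borel_on X)" using sets.top[of "borel_on X"] by (simp only: space_state)
  let ?post = "\<lambda>v. emeasure (filtering pi0 K g v (Suc n)) A"
  let ?u = "\<lambda>p. (fst p)(Suc n := snd p)"
  have post: "?post \<in> borel_measurable (obs_space (Suc n))"
    by (rule measurable_emeasure_kernel[OF filtering_past_obs_measurable A])
  have "(\<integral>\<^sup>+w. indicator C (past_obs (Suc n) w) * indicator A (State (Suc n) w) \<partial>M)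
      = (\<integral>\<^sup>+p. joint_density n A p * indicator C (?u p) \<partial>past_and_lebesgue n)"
    using joint_density_correct[OF correct A borel_measurable_indicator[OF C]] by (simp add: mult.commute)
  also have "\<dots> = (\<integral>\<^sup>+p. joint_density n X p * (indicator C (?u p) * ?post (?u p)) \<partial>past_and_lebesgue n)"
  proof (rule nn_integral_cong_AE)
    show "AE p in past_and_lebesgue n. joint_density n A p * indicator C (?u p)
        = joint_density n X p * (indicator C (?u p) * ?post (?u p))"
      using likelihood_finite[OF correct] AE_space
    proof eventually_elim
      fix p assume fin: "joint_density n X p \<noteq> \<infinity>" and p: "p \<in> space (past_and_lebesgue n)"
      obtain v y where vy: "p = (v, y)" by (cases p)
      have "space (past_and_lebesgue n) = space (obs_space n) \<times> Y"
        using sets_eq_imp_space_eq[OF sets_past_and_lebesgue[of n]] by (simp add: space_pair_measure space_restrict_space)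
      then have "?post (?u p) = joint_density n A p / joint_density n X p"
        using p vy bayes_formula[OF _ _ A, of v n y] by simp
      moreover have "joint_density n X p * (joint_density n A p / joint_density n X p) = joint_density n A p"
      \<comment> \<open>The denominator dominates the numerator, so \<open>0 / 0 = 0\<close> is the right value where it vanishes.\<close>
      proof (cases "joint_density n X p = 0")
        case True
        have "A \<subseteq> X" using sets.sets_into_space[OF A] by (simp add: space_state)
        then have "joint_density n A p = 0" using joint_density_mono[of A X n p] True by simp
        then show ?thesis by simp
      next
        case False
        then show ?thesis using fin by (simp add: ennreal_times_divide mult_divide_eq_ennreal mult.commute)
      qed
      ultimately show "joint_density n A p * indicator C (?u p)
          = joint_density n X p * (indicator C (?u p) * ?post (?u p))"
        by (simp add: mult_ac indicator_def)
    qed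
  qed
  also have "\<dots> = (\<integral>\<^sup>+w. indicator X (State (Suc n) w) * (indicator C (past_obs (Suc n) w) * ?post (past_obs (Suc n) w)) \<partial>M)"
    by (intro joint_density_correct[OF correct X, symmetric]
        borel_measurable_times_ennreal borel_measurable_indicator C post)
  also have "\<dots> = (\<integral>\<^sup>+w. indicator C (past_obs (Suc n) w) * ?post (past_obs (Suc n) w) \<partial>M)"
    by (intro nn_integral_cong) (simp add: State_in)
  finally show "(\<integral>\<^sup>+w. indicator C (past_obs (Suc n) w) * indicator A (State (Suc n) w) \<partial>M)
      = (\<integral>\<^sup>+w. indicator C (past_obs (Suc n) w) * ?post (past_obs (Suc n) w) \<partial>M)" .
qed

lemma filter_always_correct: "filter_correct n"
  by (induction n) (rule filter_correct_0, rule filter_correct_Suc)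

section \<open>Mean measures\<close>

lemma emeasure_mean_filter:
  assumes "A \<in> sets (borel_on X)"
  shows "emeasure (mean_filter M X pi0 K g Obs n) A = (\<integral>\<^sup>+w. emeasure (random_filter pi0 K g Obs n w) A \<partial>M)"
  unfolding mean_filter_def by (rule emeasure_mean_measure[OF random_filter_measurable assms])

lemma sets_mean_filter: "sets (mean_filter M X pi0 K g Obs n) = sets (borel_on X)"
  unfolding mean_filter_def mean_measure_def by (rule sets.sets_measure_of_eq)

text \<open>
  The tower property: correctness of the filter, applied to the event of all observation sequences.
\<close>

lemma mean_filter_eq_state_law: "mean_filter M X pi0 K g Obs n = distr M (borel_on X) (State n)"
proof (rule measure_eqI)
  show "sets (mean_filter M X pi0 K g Obs n) = sets (distr M (borel_on X) (State n))"
    by (simp add: sets_mean_filter)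
  fix A assume "A \<in> sets (mean_filter M X pi0 K g Obs n)"
  then have A[measurable]: "A \<in> sets (borel_on X)" by (simp add: sets_mean_filter)
  have past: "indicator (space (obs_space n)) (past_obs n w) = (1::ennreal)" if "w \<in> space M" for w
    using measurable_space[OF past_obs_measurable that] by simp
  have "emeasure (mean_filter M X pi0 K g Obs n) A
      = (\<integral>\<^sup>+w. indicator (space (obs_space n)) (past_obs n w) * emeasure (filtering pi0 K g (past_obs n w) n) A \<partial>M)"
    unfolding emeasure_mean_filter[OF A]
  proof (rule nn_integral_cong)
    fix w assume w: "w \<in> space M"
    have "filtering pi0 K g (past_obs n w) n = random_filter pi0 K g Obs n w"
      unfolding random_filter_def past_obs_def by (rule filtering_cong) simp
    then show "emeasure (random_filter pi0 K g Obs n w) A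
        = indicator (space (obs_space n)) (past_obs n w) * emeasure (filtering pi0 K g (past_obs n w) n) A"
      by (simp only: past[OF w] mult_1)
  qed
  also have "\<dots> = (\<integral>\<^sup>+w. indicator (space (obs_space n)) (past_obs n w) * indicator A (State n w) \<partial>M)"
    using bspec[OF bspec[OF filter_always_correct[of n, unfolded filter_correct_def] sets.top] A] by (rule sym)
  also have "\<dots> = (\<integral>\<^sup>+w. indicator A (State n w) \<partial>M)"
    by (intro nn_integral_cong) (simp only: past mult_1)
  also have "\<dots> = (\<integral>\<^sup>+x. indicator A x \<partial>distr M (borel_on X) (State n))"
    by (rule nn_integral_distr[symmetric]) auto
  also have "\<dots> = emeasure (distr M (borel_on X) (State n)) A" by simp
  finally show "emeasure (mean_filter M X pi0 K g Obs n) A = emeasure (distr M (borel_on X) (State n)) A" .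
qed

lemma state_law_Suc:
  "distr M (borel_on X) (State (Suc n)) = kernel_push (K (Suc n)) (distr M (borel_on X) (State n))"
proof (rule measure_eqI)
  let ?D = "distr M (borel_on X) (State n)"
  have K: "K (Suc n) \<in> ?D \<rightarrow>\<^sub>M subprob_algebra (borel_on X)"
    using kernel_measurable by (simp only: measurable_distr_eq1)
  obtain w where "w \<in> space M" using not_empty by blast
  then have ne: "space (borel_on X) \<noteq> {}" using State_in[of w] by (auto simp: space_state)
  then have ne': "space ?D \<noteq> {}" by simp
  show "sets (distr M (borel_on X) (State (Suc n))) = sets (kernel_push (K (Suc n)) ?D)"
    unfolding kernel_push_def using sets_bind[OF sets_kernel[OF K] ne'] by simp
  fix A assume "A \<in> sets (distr M (borel_on X) (State (Suc n)))"
  then have A[measurable]: "A \<in> sets (borel_on X)" by simp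
  have "emeasure (distr M (borel_on X) (State (Suc n))) A = (\<integral>\<^sup>+x. indicator A x \<partial>distr M (borel_on X) (State (Suc n)))"
    by simp
  also have "\<dots> = (\<integral>\<^sup>+w. 1 * indicator A (State (Suc n) w) \<partial>M)"
    by (subst nn_integral_distr) auto
  also have "\<dots> = (\<integral>\<^sup>+w. emeasure (K (Suc n) (State n w)) A \<partial>M)"
    using nn_integral_markov[OF A, of "\<lambda>_. 1" n] by simp
  also have "\<dots> = (\<integral>\<^sup>+x. emeasure (K (Suc n) x) A \<partial>?D)"
    using measurable_emeasure_kernel[OF kernel_measurable A] by (subst nn_integral_distr) auto
  also have "\<dots> = emeasure (kernel_push (K (Suc n)) ?D) A"
    by (rule emeasure_kernel_push[OF _ ne K_kernel A, symmetric]) auto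
  finally show "emeasure (distr M (borel_on X) (State (Suc n))) A = emeasure (kernel_push (K (Suc n)) ?D) A" .
qed

end

theorem theorem2p7:
  fixes M :: "'w measure"
    and X :: "'x::euclidean_space set"
    and Y :: "'y::euclidean_space set"
    and pi0 :: "'x measure"
    and K :: "nat \<Rightarrow> 'x \<Rightarrow> 'x measure"
    and g :: "nat \<Rightarrow> 'y \<Rightarrow> 'x \<Rightarrow> real"
    and State :: "nat \<Rightarrow> 'w \<Rightarrow> 'x"
    and Obs :: "nat \<Rightarrow> 'w \<Rightarrow> 'y"
  assumes "state_space_process M X Y pi0 K g State Obs"
  shows "mean_filter M X pi0 K g Obs 0 = pi0 \<and>
    (\<forall>t\<ge>1.
      mean_filter M X pi0 K g Obs t = kernel_push (K t) (mean_filter M X pi0 K g Obs (t - 1)) \<and>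
      (\<forall>f \<in> borel_measurable (borel_on X).
        (\<integral>\<^sup>+ x. ennreal (f x) \<partial>mean_filter M X pi0 K g Obs t)
          = (\<integral>\<^sup>+ x. ennreal (f x) \<partial>kernel_push (K t) (mean_filter M X pi0 K g Obs (t - 1))) \<and>
        (integrable (mean_filter M X pi0 K g Obs t) f
          \<longleftrightarrow> integrable (kernel_push (K t) (mean_filter M X pi0 K g Obs (t - 1))) f) \<and>
        (integrable (mean_filter M X pi0 K g Obs t) f \<longrightarrow>
          (\<integral>x. f x \<partial>mean_filter M X pi0 K g Obs t)
            = (\<integral>x. f x \<partial>kernel_push (K t) (mean_filter M X pi0 K g Obs (t - 1))))))"
proof -
  interpret state_space_process M X Y pi0 K g State Obs by (rule assms)
  have initial: "mean_filter M X pi0 K g Obs 0 = pi0"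
    by (simp only: mean_filter_eq_state_law initial_law)
  have recursion: "mean_filter M X pi0 K g Obs t = kernel_push (K t) (mean_filter M X pi0 K g Obs (t - 1))"
    if t: "t \<ge> 1" for t
  proof -
    have "Suc (t - 1) = t" using t by simp
    then show ?thesis
      using state_law_Suc[of "t - 1"] by (simp only: mean_filter_eq_state_law)
  qed
  show ?thesis
  proof (intro conjI allI impI ballI)
    show "mean_filter M X pi0 K g Obs 0 = pi0" by (rule initial)
  qed (simp_all only: recursion[symmetric])
qed

end
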